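(* Let $n\ge 3$. For each of the shape descriptors $\Pi\in\{\text{OBB},\text{PC},\text{STRIP}\}$ on sets of $n$ points in the plane, the topological stability ratio restricted to stateless algorithms is infinite: $\rho_{TS}(\text{OBB})=\rho_{TS}(\text{PC})=\rho_{TS}(\text{STRIP})=\infty$. That is, for every stateless algorithm $\mathcal{A}$ whose output $\mathcal{A}(P(t))$ is continuous in $t$ for every continuously moving set $P(t)$ of $n$ points, $$\sup_{P(t)}\ \max_{t\in[0,T]}\frac{f_\Pi(\mathcal{A}(P(t)),P(t))}{\min_\gamma f_\Pi(\gamma,P(t))}=\infty .$$
   Context: A point set $P$ is an $n$-tuple of points of $\mathbb{R}^2$, viewed as an element of $\mathbb{R}^{2n}$, such that not all points are at the same position. A continuously moving point set is $P(t)=\{p_1(t),\dots,p_n(t)\}$, $t\in[0,T]$, where each $p_i:[0,T]\to\mathbb{R}^2$ is continuous and at each time $t$ not all points are at the same position. An orientation is an element of the real projective line $O=\mathbb{RP}^1$ (topologically a circle), represented by a unit vector $\alpha\in\mathbb{R}^2$ with opposite vectors identified. Let $\alpha^\perp$ be the orientation orthogonal to $\alpha$, $w_\alpha(P)=\max_{p,q\in P}(p-q)\cdot\alpha$ the extent of $P$ along $\alpha$, $\mathcal{L}(\alpha)$ the set of lines with orientation $\alpha$, and $d(L,p)$ the Euclidean distance from the point $p$ to the line $L$. The cost functions are - $f_{\text{PC}}(\alpha,P)=\min_{L\in\mathcal{L}(\alpha)}\sum_{p\in P}d(L,p)^2$ (first principal component), - $f_{\text{OBB}}(\alpha,P)=w_\alpha(P)\,w_{\alpha^\perp}(P)$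 (oriented bounding box), - $f_{\text{STRIP}}(\alpha,P)=w_{\alpha^\perp}(P)$ (covering strip). A stateless algorithm is one whose output orientation at time $t$ depends only on the input $P(t)$ at that time, i.e. a map $\mathcal{A}$ from point sets to $O$. The topological stability ratio of $\Pi$ is $$\rho_{TS}(\Pi)=\inf_{\mathcal{A}}\sup_{P(t)}\max_{t\in[0,T]}\frac{f_\Pi(\mathcal{A}(P(t)),P(t))}{\min_\gamma f_\Pi(\gamma,P(t))},$$ where the supremum is over continuously moving point sets and the infimum is over all (here: stateless) algorithms for which $\mathcal{A}(P(t))$ is continuous in $t$ for every continuously moving $P(t)$. Convention: if the minimum cost is $0$, the ratio is $1$ if the numerator is $0$ and $\infty$ otherwise. *)

theory Defs
  imports "HOL-Analysis.Analysis"
begin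

section \<open>Orientations: the real projective line\<close>

quotient_type orientation =
  "real^2" / partial: "\<lambda>a b. norm a = 1 \<and> norm b = 1 \<and> (a = b \<or> a = - b)"
  morphisms rep_orientation orientation_of
proof (rule part_equivpI)
  show "\<exists>a::real^2. norm a = 1 \<and> norm a = 1 \<and> (a = a \<or> a = - a)"
    by (rule exI[of _ "axis 1 1"]) simp
qed (auto simp: symp_def transp_def)

text \<open>The quotient topology from the unit circle.\<close>

instantiation orientation :: topological_space
begin

definition open_orientation :: "orientation set \<Rightarrow> bool" where
  "open_orientation U \<longleftrightarrow>
     openin (top_of_set (sphere 0 1)) {a \<in> sphere 0 1. orientation_of a \<in> U}"

instance
proof
  show "open (UNIV :: orientation set)"
    using openin_topspace[of "top_of_set (sphere (0::real^2) 1)"]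
    by (simp add: open_orientation_def sphere_def)
next
  fix S T :: "orientation set"
  assume ST: "open S" "open T"
  have eq: "{a \<in> sphere 0 1. orientation_of a \<in> S \<inter> T} =
      {a \<in> sphere 0 1. orientation_of a \<in> S} \<inter> {a \<in> sphere 0 1. orientation_of a \<in> T}"
    by blast
  show "open (S \<inter> T)"
    unfolding open_orientation_def eq
    by (rule openin_Int) (rule ST[unfolded open_orientation_def])+
next
  fix K :: "orientation set set"
  assume K: "\<forall>S\<in>K. open S"
  have eq: "{a \<in> sphere 0 1. orientation_of a \<in> \<Union>K} =
      (\<Union>S\<in>K. {a \<in> sphere 0 1. orientation_of a \<in> S})"
    by blast
  show "open (\<Union>K)"
    unfolding open_orientation_def eq
    by (rule openin_Union) (use K[unfolded open_orientation_def] in blast)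
qed

end

lemma orientation_of_surj: "\<exists>a. norm a = 1 \<and> \<alpha> = orientation_of a"
  using Quotient3_abs_rep[OF Quotient3_orientation, of \<alpha>]
    Quotient3_rep_reflp[OF Quotient3_orientation, of \<alpha>]
  by (intro exI[of _ "rep_orientation \<alpha>"]) simp

lemma orientation_of_eq_iff:
  assumes "norm a = 1" "norm b = 1"
  shows "orientation_of a = orientation_of b \<longleftrightarrow> a = b \<or> a = - b"
  using Quotient3_rel[OF Quotient3_orientation, of a b] assms by auto

lemma quotient_map_orientation_of:
  "quotient_map (top_of_set (sphere 0 1)) euclidean orientation_of"
  unfolding quotient_map_def
proof (intro conjI allI impI)
  show "orientation_of ` topspace (top_of_set (sphere 0 1)) = topspace euclidean"
  proof -
    have "\<alpha> \<in> orientation_of ` sphere 0 1" for \<alpha>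
    proof -
      obtain a where "norm a = 1" "\<alpha> = orientation_of a"
        using orientation_of_surj by blast
      then show ?thesis
        by (intro image_eqI[of _ _ a]) simp_all
    qed
    then show ?thesis
      unfolding topspace_euclidean_subtopology topspace_euclidean by blast
  qed
qed (simp add: open_orientation_def)


section \<open>Point sets and cost functions\<close>

text \<open>A tuple of points is a vector indexed by a finite type, so that coinciding points
  are counted with multiplicity.\<close>

definition point_set :: "(real^2)^'n::finite \<Rightarrow> bool" where
  "point_set P \<longleftrightarrow> (\<exists>i j. P $ i \<noteq> P $ j)"

lift_definition perp :: "orientation \<Rightarrow> orientation" is
  "\<lambda>a::real^2. vector [- a $ 2, a $ 1]"
proof -
  fix a b :: "real^2"
  assume ab: "norm a = 1 \<and> norm b = 1 \<and> (a = b \<or> a = - b)"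
  have "norm (vector [- c $ 2, c $ 1] :: real^2) = norm c" for c :: "real^2"
    by (simp add: norm_vec_def L2_set_def sum_2 add.commute)
  moreover have "(vector [- (- b) $ 2, (- b) $ 1] :: real^2) = - vector [- b $ 2, b $ 1]"
    by (simp add: vec_eq_iff forall_2)
  ultimately show "norm (vector [- a $ 2, a $ 1] :: real^2) = 1 \<and>
      norm (vector [- b $ 2, b $ 1] :: real^2) = 1 \<and>
      ((vector [- a $ 2, a $ 1] :: real^2) = vector [- b $ 2, b $ 1] \<or>
       (vector [- a $ 2, a $ 1] :: real^2) = - vector [- b $ 2, b $ 1])"
    using ab by (elim conjE disjE) (simp_all only: simp_thms norm_minus_cancel)
qed

lift_definition extent :: "orientation \<Rightarrow> (real^2)^'n::finite \<Rightarrow> real" is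
  "\<lambda>a P. Max {(P $ i - P $ j) \<bullet> a | i j. True}"
proof -
  have sub: "{(P $ i - P $ j) \<bullet> (- b) | i j. True} \<subseteq> {(P $ i - P $ j) \<bullet> b | i j. True}"
    for b :: "real^2" and P :: "(real^2)^'n"
  proof clarify
    fix i j
    have "(P $ i - P $ j) \<bullet> (- b) = (P $ j - P $ i) \<bullet> b"
      by (simp add: inner_diff_left)
    then show "\<exists>i' j'. (P $ i - P $ j) \<bullet> (- b) = (P $ i' - P $ j') \<bullet> b \<and> True"
      by blast
  qed
  have neg: "{(P $ i - P $ j) \<bullet> (- b) | i j. True} = {(P $ i - P $ j) \<bullet> b | i j. True}"
    for b :: "real^2" and P :: "(real^2)^'n"
    using sub[of P b] sub[of P "- b"] unfolding minus_minus by (rule equalityI)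
  show "(\<lambda>P::(real^2)^'n. Max {(P $ i - P $ j) \<bullet> a | i j. True}) =
      (\<lambda>P. Max {(P $ i - P $ j) \<bullet> b | i j. True})"
    if "norm a = 1 \<and> norm b = 1 \<and> (a = b \<or> a = - b)"
    for a b :: "real^2"
  proof (cases "a = b")
    case False
    with that have "a = - b" by blast
    then show ?thesis by (simp only: neg)
  qed (simp only:)
qed

lift_definition lines_along :: "orientation \<Rightarrow> (real^2) set set" is
  "\<lambda>a. {{x + s *\<^sub>R a | s. True} | x. True}"
proof -
  have sub: "{x + s *\<^sub>R (- b) | s. True} \<subseteq> {x + s *\<^sub>R b | s. True}" for x b :: "real^2"
  proof clarify
    fix s
    have "x + s *\<^sub>R (- b) = x + (- s) *\<^sub>R b"
      by simp
    then show "\<exists>s'. x + s *\<^sub>R (- b) = x + s' *\<^sub>R b \<and> True"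
      by blast
  qed
  have neg: "{x + s *\<^sub>R (- b) | s. True} = {x + s *\<^sub>R b | s. True}" for x b :: "real^2"
    using sub[of x b] sub[of x "- b"] unfolding minus_minus by (rule equalityI)
  show "{{x + s *\<^sub>R a | s. True} | x. True} = {{x + s *\<^sub>R b | s. True} | x. True}"
    if "norm a = 1 \<and> norm b = 1 \<and> (a = b \<or> a = - b)" for a b :: "real^2"
  proof (cases "a = b")
    case False
    with that have "a = - b" by blast
    then show ?thesis by (simp only: neg)
  qed (simp only:)
qed

datatype descriptor = OBB | PC | STRIP

fun cost :: "descriptor \<Rightarrow> orientation \<Rightarrow> (real^2)^'n::finite \<Rightarrow> real" where
  "cost PC \<alpha> P = (INF L\<in>lines_along \<alpha>. \<Sum>i\<in>UNIV. (infdist (P $ i) L)\<^sup>2)"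
| "cost OBB \<alpha> P = extent \<alpha> P * extent (perp \<alpha>) P"
| "cost STRIP \<alpha> P = extent (perp \<alpha>) P"

definition cost_ratio :: "descriptor \<Rightarrow> orientation \<Rightarrow> (real^2)^'n::finite \<Rightarrow> ereal" where
  "cost_ratio D \<alpha> P =
     (let m = (INF \<gamma>. cost D \<gamma> P) in
      if m = 0 then (if cost D \<alpha> P = 0 then 1 else \<infinity>) else ereal (cost D \<alpha> P / m))"


section \<open>Moving point sets and topological stability\<close>

definition moving_point_set :: "real \<Rightarrow> (real \<Rightarrow> (real^2)^'n::finite) \<Rightarrow> bool" where
  "moving_point_set T P \<longleftrightarrow>
     (\<forall>i. continuous_on {0..T} (\<lambda>t. P t $ i)) \<and> (\<forall>t\<in>{0..T}. point_set (P t))"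

text \<open>A stateless algorithm is a function from point tuples to orientations. Its values at
  tuples that are not point sets are never inspected.\<close>

definition continuous_algorithm :: "real \<Rightarrow> ((real^2)^'n::finite \<Rightarrow> orientation) \<Rightarrow> bool" where
  "continuous_algorithm T \<A> \<longleftrightarrow>
     (\<forall>P. moving_point_set T P \<longrightarrow> continuous_on {0..T} (\<lambda>t. \<A> (P t)))"

text \<open>The maximum over time is a supremum in the extended reals: the ratio need not be
  continuous at times where the minimum cost vanishes.\<close>

definition stability_ratio_of ::
    "real \<Rightarrow> descriptor \<Rightarrow> ((real^2)^'n::finite \<Rightarrow> orientation) \<Rightarrow> ereal" where
  "stability_ratio_of T D \<A> =
     (SUP P\<in>{P. moving_point_set T P}. SUP t\<in>{0..T}. cost_ratio D (\<A> (P t)) (P t))"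

text \<open>The number of points is the cardinality of the index type.\<close>

definition topological_stability_ratio ::
    "'n::finite itself \<Rightarrow> real \<Rightarrow> descriptor \<Rightarrow> ereal" where
  "topological_stability_ratio _ T D =
     (INF \<A>\<in>{\<A> :: (real^2)^'n \<Rightarrow> orientation. continuous_algorithm T \<A>}.
        stability_ratio_of T D \<A>)"

end

theory Submission
  imports Defs
begin

text \<open>Keep all points but two at the origin and put the other two at \<open>z\<close> and \<open>(1 - \<bar>z\<bar>) e\<close>,
  with \<open>z\<close> in the closed unit disc and \<open>e\<close> a fixed unit vector: these are point sets, and for
  \<open>\<bar>z\<bar> = 1\<close> they are collinear with optimal cost 0. If the ratio were finite there, the output of
  the algorithm would have to be parallel (or, for OBB, possibly orthogonal) to \<open>z\<close>. The fourth
  power of a unit vector forgets both the sign and the quarter turn, so the fourth power of the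
  output would extend \<open>z \<mapsto> z\<^sup>4\<close> from the circle to a map from the disc to the circle. Its fourth
  root on the disc would then be, up to a constant factor, a retraction onto the circle.\<close>

section \<open>Topology: continuity along paths, and circle-valued maps on the disc\<close>

text \<open>A convergent sequence of points of a convex set is traversed by a path, at the times
  \<open>T / (n + 1)\<close>, by Dugundji's extension theorem.\<close>

lemma continuous_on_if_continuous_along_paths:
  fixes f :: "'a::{metric_space, real_inner} \<Rightarrow> 'b::topological_space" and T :: real
  assumes "convex S" and "T > 0"
    and along: "\<And>g. continuous_on {0..T} g \<Longrightarrow> g ` {0..T} \<subseteq> S \<Longrightarrow>
      continuous_on {0..T} (\<lambda>t. f (g t))"
  shows "continuous_on S f"
proof (rule continuous_on_sequentiallyI)
  fix u a
  assume u: "\<forall>n. u n \<in> S" "a \<in> S" "u \<longlonglongrightarrow> a"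
  define s where "s n = T / real (Suc n)" for n
  have s_lim: "s \<longlonglongrightarrow> 0"
    unfolding s_def by (rule LIMSEQ_Suc[OF lim_const_over_n])
  have s_pos: "0 < s n" and s_le: "s n \<le> T" for n
    using \<open>T > 0\<close> by (auto simp: s_def field_simps)
  have "inj s"
    using \<open>T > 0\<close> by (auto simp: inj_def s_def)
  define K where "K = insert 0 (range s)"
  have "closed K"
    unfolding K_def by (intro compact_imp_closed compact_sequence_with_limit s_lim)
  \<comment> \<open>At time 0 the default is the limit \<open>a\<close>; since \<open>s\<close> is
    injective, \<open>inv s\<close> recovers the index at every other time in
    \<open>K\<close>.\<close>
  define h where "h t = (if t = 0 then a else u (inv s t))" for t
  have h_s: "h (s n) = u n" for n
    using s_pos[of n] \<open>inj s\<close> by (simp add: h_def)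
  have "continuous_on K h"
    unfolding continuous_on_eq_continuous_within
  proof
    fix x assume "x \<in> K"
    show "continuous (at x within K) h"
    proof (cases "x = 0")
      case False
      \<comment> \<open>Nonzero points of \<open>K\<close> are isolated, because a convergent
        sequence has no limit point besides its limit.\<close>
      then have "\<not> x islimpt K"
        using sequence_unique_limpt[OF s_lim] by (auto simp: K_def islimpt_insert)
      then show ?thesis
        by (simp add: continuous_trivial_limit trivial_limit_within)
    next
      case True
      have "\<exists>d>0. \<forall>y\<in>K. dist y 0 < d \<longrightarrow> dist (h y) (h 0) < e" if "e > 0" for e
      proof -
        obtain N where N: "\<And>n. n \<ge> N \<Longrightarrow> dist (u n) a < e"
          using u(3) \<open>e > 0\<close> by (auto simp: lim_sequentially)
        \<comment> \<open>The radius \<open>s N\<close> works because \<open>s\<close> decreases: a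
          time below \<open>s N\<close> has an index beyond \<open>N\<close>.\<close>
        have "dist (h y) (h 0) < e" if "y \<in> K" "dist y 0 < s N" for y
        proof (cases "y = 0")
          case False
          then obtain n where n: "y = s n"
            using \<open>y \<in> K\<close> by (auto simp: K_def)
          have "n \<ge> N"
          proof (rule ccontr)
            assume "\<not> n \<ge> N"
            then have "s N \<le> s n"
              using \<open>T > 0\<close> by (auto simp: s_def intro!: divide_left_mono)
            then show False
              using that n s_pos[of n] by simp
          qed
          then show ?thesis
            using N by (simp add: n h_s) (simp add: h_def)
        qed (use \<open>e > 0\<close> in simp)
        then show ?thesis
          using s_pos[of N] by blast
      qed
      then show ?thesis
        unfolding continuous_within_eps_delta True by blast
    qed
  qed
  moreover have "h ` K \<subseteq> S"
    using u by (auto simp: K_def h_s) (simp add: h_def)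
  ultimately obtain g where g: "continuous_on UNIV g" "g ` UNIV \<subseteq> S"
      "\<And>x. x \<in> K \<Longrightarrow> g x = h x"
    using Dugundji[of S UNIV K h] \<open>convex S\<close> \<open>a \<in> S\<close> \<open>closed K\<close> by auto
  have "continuous_on {0..T} (\<lambda>t. f (g t))"
    using g by (intro along) (auto intro: continuous_on_subset)
  moreover have "s n \<in> {0..T}" for n
    using s_pos[of n] s_le[of n] by simp
  moreover have "0 \<in> {0..T}"
    using \<open>T > 0\<close> by simp
  ultimately have "(\<lambda>n. f (g (s n))) \<longlonglongrightarrow> f (g 0)"
    using s_lim unfolding continuous_on_sequentially comp_def by blast
  moreover have "g (s n) = u n" "g 0 = a" for n
    using g(3) h_s by (auto simp: K_def h_def)
  ultimately show "(\<lambda>n. f (u n)) \<longlonglongrightarrow> f a"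
    by simp
qed

text \<open>On the disc \<open>h\<close> has a continuous logarithm \<open>g\<close>, so
  \<open>exp (g z / n)\<close> is a continuous \<open>n\<close>-th root \<open>k\<close> of
  \<open>h\<close>. If \<open>h\<close> were the power map on the circle, \<open>k z / z\<close>
  would be an \<open>n\<close>-th root of unity there, hence constant by connectedness, and dividing
  \<open>k\<close> by this constant would retract the disc onto its boundary.\<close>

lemma no_circle_valued_extension_of_power:
  fixes h :: "complex \<Rightarrow> complex"
  assumes cont: "continuous_on (cball 0 1) h" and unit: "\<And>z. z \<in> cball 0 1 \<Longrightarrow> norm (h z) = 1"
    and "n > 0"
  shows "\<exists>z \<in> sphere 0 1. h z \<noteq> z ^ n"
proof (rule ccontr)
  assume "\<not> ?thesis"
  then have h: "h z = z ^ n" if "norm z = 1" for z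
    using that by auto
  obtain g where g: "continuous_on (cball 0 1) g" "\<And>z. z \<in> cball 0 1 \<Longrightarrow> h z = exp (g z)"
    by (rule continuous_logarithm_on_cball[OF cont]) (use unit in fastforce)+
  define k where "k z = exp (g z / of_nat n)" for z
  have k_cont: "continuous_on (cball 0 1) k"
    unfolding k_def by (intro continuous_intros g) (use \<open>n > 0\<close> in auto)
  have k_pow: "k z ^ n = h z" if "z \<in> cball 0 1" for z
    using \<open>n > 0\<close> by (simp add: k_def g(2)[OF that] exp_of_nat_mult[symmetric])
  have k_norm: "norm (k z) = 1" if "z \<in> cball 0 1" for z
  proof -
    have "norm (k z) ^ n = 1"
      using k_pow[OF that] unit[OF that] by (metis norm_power)
    then show ?thesis
      using \<open>n > 0\<close> power_eq_imp_eq_base[of "norm (k z)" n 1] by simp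
  qed
  have "(\<lambda>z. k z / z) constant_on sphere 0 1"
  proof (rule continuous_finite_range_constant)
    show "connected (sphere (0::complex) 1)"
      by (simp add: connected_sphere)
    show "continuous_on (sphere 0 1) (\<lambda>z. k z / z)"
      by (intro continuous_intros continuous_on_subset[OF k_cont]) auto
    have "(\<lambda>z. k z / z) ` sphere 0 1 \<subseteq> {w. w ^ n = 1}"
      using k_pow h by (auto simp: power_divide)
    then show "finite ((\<lambda>z. k z / z) ` sphere 0 1)"
      using finite_roots_unity[of n] \<open>n > 0\<close> by (auto intro: finite_subset)
  qed
  then obtain c where c: "\<And>z. norm z = 1 \<Longrightarrow> k z / z = c"
    by (auto simp: constant_on_def)
  have "norm c = 1"
    using c[of 1] k_norm[of 1] by auto
  have "retraction (cball 0 1) (sphere 0 1) (\<lambda>z. k z / c)"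
    unfolding retraction_def
  proof (intro conjI ballI)
    show "continuous_on (cball 0 1) (\<lambda>z. k z / c)"
      using \<open>norm c = 1\<close> by (intro continuous_intros k_cont) auto
    show "(\<lambda>z. k z / c) \<in> cball 0 1 \<rightarrow> sphere 0 1"
      using k_norm \<open>norm c = 1\<close> by (auto simp: norm_divide)
    show "k z / c = z" if "z \<in> sphere 0 1" for z
      using c[of z] that \<open>norm c = 1\<close> by (auto simp: field_simps)
  qed auto
  then show False
    using no_retraction_cball[of 1 "0::complex"] by (auto simp: retract_of_def)
qed

section \<open>Complex coordinates for orientations and their fourth power\<close>

text \<open>Complex numbers turn the quarter turn behind \<open>perp\<close> into multiplication by
  \<open>\<i>\<close> and supply the powers of a direction.\<close>

definition complex_vec :: "complex \<Rightarrow> real^2" where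
  "complex_vec z = vector [Re z, Im z]"

lemma complex_vec_nth [simp]: "complex_vec z $ 1 = Re z" "complex_vec z $ 2 = Im z"
  by (simp_all add: complex_vec_def)

lemma norm_complex_vec [simp]: "norm (complex_vec z) = norm z"
  by (simp add: norm_vec_def L2_set_def sum_2 cmod_def)

lemma inner_complex_vec [simp]: "complex_vec z \<bullet> complex_vec w = z \<bullet> w"
  by (simp add: inner_vec_def sum_2 inner_complex_def)

lemma complex_vec_0 [simp]: "complex_vec 0 = 0"
  by (simp add: vec_eq_iff forall_2)

lemma complex_vec_minus [simp]: "complex_vec (- z) = - complex_vec z"
  by (simp add: vec_eq_iff forall_2)

lemma complex_vec_eq_iff [simp]: "complex_vec z = complex_vec w \<longleftrightarrow> z = w"
  by (simp add: vec_eq_iff forall_2 complex_eq_iff)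

lemma complex_vec_Complex: "complex_vec (Complex (a $ 1) (a $ 2)) = a"
  by (simp add: vec_eq_iff forall_2)

lemma continuous_on_complex_vec: "continuous_on S complex_vec"
proof -
  have eq: "complex_vec = (\<lambda>z. \<chi> i. if i = 1 then Re z else Im z)"
    by (simp add: fun_eq_iff vec_eq_iff forall_2)
  have "continuous_on S (\<lambda>z. if i = 1 then Re z else Im z)" for i :: 2
    by (cases "i = 1") (simp_all add: continuous_intros)
  then show ?thesis
    unfolding eq by (rule continuous_on_vec_lambda)
qed

definition direction :: "complex \<Rightarrow> orientation" where
  "direction z = orientation_of (complex_vec z)"

lemma direction_cases:
  obtains z where "norm z = 1" "\<alpha> = direction z"
  using orientation_of_surj[of \<alpha>] complex_vec_Complex norm_complex_vec
  unfolding direction_def by metis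

lemma direction_eq_iff:
  assumes "norm z = 1" "norm w = 1"
  shows "direction z = direction w \<longleftrightarrow> z = w \<or> z = - w"
  using assms unfolding direction_def
  by (subst orientation_of_eq_iff) (auto simp flip: complex_vec_minus)

text \<open>The chosen representative is determined up to sign, which the even power
  removes.\<close>

definition direction_pow4 :: "orientation \<Rightarrow> complex" where
  "direction_pow4 \<alpha> = (SOME z. norm z = 1 \<and> \<alpha> = direction z) ^ 4"

lemma direction_pow4:
  assumes "norm z = 1"
  shows "direction_pow4 (direction z) = z ^ 4"
proof -
  define w where "w = (SOME w. norm w = 1 \<and> direction z = direction w)"
  have "norm w = 1 \<and> direction z = direction w"
    unfolding w_def by (rule someI[of _ z]) (use assms in simp)
  then have "w = z \<or> w = - z"
    using direction_eq_iff[of w z] assms by auto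
  then show ?thesis
    by (auto simp: direction_pow4_def w_def[symmetric])
qed

lemma norm_direction_pow4: "norm (direction_pow4 \<alpha>) = 1"
  by (rule direction_cases[of \<alpha>]) (simp add: direction_pow4 norm_power)

text \<open>By the quotient map, continuity need only be checked on the unit circle, where the
  composite is a polynomial in the coordinates.\<close>

lemma continuous_on_direction_pow4: "continuous_on UNIV direction_pow4"
proof -
  have "continuous_on (sphere 0 1) (direction_pow4 \<circ> orientation_of)"
  proof (rule continuous_on_eq)
    show "continuous_on (sphere 0 1) (\<lambda>a::real^2. Complex (a $ 1) (a $ 2) ^ 4)"
      by (intro continuous_intros)
    show "Complex (a $ 1) (a $ 2) ^ 4 = (direction_pow4 \<circ> orientation_of) a"
      if "a \<in> sphere 0 1" for a
    proof -
      have "norm (Complex (a $ 1) (a $ 2)) = 1"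
        using that by (metis complex_vec_Complex norm_complex_vec mem_sphere_0)
      from direction_pow4[OF this] show ?thesis
        by (simp add: direction_def complex_vec_Complex)
    qed
  qed
  then have "continuous_map euclidean euclidean direction_pow4"
    by (intro continuous_compose_quotient_map[OF quotient_map_orientation_of])
      (simp add: continuous_map_iff_continuous)
  then show ?thesis by simp
qed

section \<open>Extents, line distances and vanishing costs\<close>

lemma perp_direction:
  assumes "norm z = 1"
  shows "perp (direction z) = direction (\<i> * z)"
proof -
  have "complex_vec (\<i> * z) = vector [- complex_vec z $ 2, complex_vec z $ 1]"
    by (simp add: vec_eq_iff forall_2)
  then show ?thesis
    using assms by (simp add: direction_def perp.abs_eq)
qed

lemma extent_direction:
  assumes "norm z = 1"
  shows "extent (direction z) P = Max {(P $ i - P $ j) \<bullet> complex_vec z | i j. True}"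
  using assms by (simp add: direction_def extent.abs_eq)

lemma finite_extent_set: "finite {(P $ i - P $ j) \<bullet> a | i j. True}"
  for P :: "(real^2)^'n::finite"
proof -
  have "{(P $ i - P $ j) \<bullet> a | i j. True} = (\<lambda>(i, j). (P $ i - P $ j) \<bullet> a) ` UNIV"
    by auto
  then show ?thesis by simp
qed

lemma extent_ge:
  assumes "norm z = 1"
  shows "(P $ i - P $ j) \<bullet> complex_vec z \<le> extent (direction z) P"
  unfolding extent_direction[OF assms] by (rule Max_ge[OF finite_extent_set]) blast

lemma extent_nonneg: "0 \<le> extent \<alpha> P"
  by (rule direction_cases[of \<alpha>]) (use extent_ge[of _ P i i for i] in simp)

lemma extent_eq_0D:
  assumes "extent (direction z) P = 0" "norm z = 1"
  shows "(P $ i - P $ j) \<bullet> complex_vec z = 0"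
  using extent_ge[of z P i j] extent_ge[of z P j i] assms by (simp add: inner_diff_left)

lemma extent_eq_0I:
  assumes "norm z = 1" "\<And>i j. (P $ i - P $ j) \<bullet> complex_vec z = 0"
  shows "extent (direction z) P = 0"
  unfolding extent_direction[OF assms(1)] assms(2) by simp

lemma lines_along_direction:
  assumes "norm z = 1"
  shows "lines_along (direction z) = {{x + s *\<^sub>R complex_vec z | s. True} | x. True}"
  using assms by (simp add: direction_def lines_along.abs_eq)

lemma pc_cost_bdd_below:
  "bdd_below ((\<lambda>L. \<Sum>i\<in>UNIV. (infdist (P $ i) L)\<^sup>2) ` lines_along \<alpha>)"
  for P :: "(real^2)^'n::finite"
  by (rule bdd_belowI[of _ 0]) (auto intro!: sum_nonneg)

lemma lines_along_nonempty: "lines_along \<alpha> \<noteq> {}"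
  by (rule direction_cases[of \<alpha>]) (use lines_along_direction in blast)

lemma cost_nonneg: "0 \<le> cost D \<alpha> P"
proof (cases D)
  case PC
  then show ?thesis
    by (auto intro!: cINF_greatest lines_along_nonempty sum_nonneg)
qed (auto intro!: mult_nonneg_nonneg extent_nonneg)

text \<open>All points of the line have the same component along its normal \<open>b\<close>, so
  Cauchy-Schwarz bounds the distance to each of them.\<close>

lemma abs_inner_le_infdist_line:
  assumes "norm a = 1" "a \<bullet> b = 0" "norm b = 1"
  shows "\<bar>(p - x) \<bullet> b\<bar> \<le> infdist p {x + s *\<^sub>R a | s. True}"
proof -
  have "\<bar>(p - x) \<bullet> b\<bar> \<le> dist p (x + s *\<^sub>R a)" for s
  proof -
    have "(p - x) \<bullet> b = (p - (x + s *\<^sub>R a)) \<bullet> b"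
      using assms by (simp add: inner_diff_left inner_add_left)
    then show ?thesis
      using Cauchy_Schwarz_ineq2[of "p - (x + s *\<^sub>R a)" b] assms by (simp add: dist_norm)
  qed
  then show ?thesis
    by (subst infdist_notempty) (auto intro!: cINF_greatest)
qed

text \<open>For any line, two of the squared distances already control the separation of the two
  points normal to it. Hence cost 0 forces every difference of points to be parallel to
  \<open>z\<close>.\<close>

lemma pc_cost_lower_bound:
  fixes P :: "(real^2)^'n::finite"
  assumes "norm z = 1"
  shows "((P $ i - P $ j) \<bullet> complex_vec (\<i> * z))\<^sup>2 / 2 \<le> cost PC (direction z) P"
proof (cases "i = j")
  case False
  have "((P $ i - P $ j) \<bullet> complex_vec (\<i> * z))\<^sup>2 / 2 \<le> (\<Sum>l\<in>UNIV. (infdist (P $ l) L)\<^sup>2)"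
    if "L \<in> lines_along (direction z)" for L
  proof -
    obtain x where L: "L = {x + s *\<^sub>R complex_vec z | s. True}"
      using \<open>L \<in> _\<close> by (auto simp: lines_along_direction[OF assms])
    define c where "c l = (P $ l - x) \<bullet> complex_vec (\<i> * z)" for l
    have c: "(c l)\<^sup>2 \<le> (infdist (P $ l) L)\<^sup>2" for l
      using abs_inner_le_infdist_line[of "complex_vec z" "complex_vec (\<i> * z)" "P $ l" x] assms
      unfolding c_def L by (intro power2_le_iff_abs_le[THEN iffD2])
        (auto simp: inner_complex_def norm_mult infdist_nonneg)
    have "((P $ i - P $ j) \<bullet> complex_vec (\<i> * z))\<^sup>2 / 2 = (c i - c j)\<^sup>2 / 2"
      by (simp add: c_def inner_diff_left)
    \<comment> \<open>Twice the right side exceeds \<open>(c i - c j)\<^sup>2\<close> by exactly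
      \<open>(c i + c j)\<^sup>2\<close>.\<close>
    also have "\<dots> \<le> (c i)\<^sup>2 + (c j)\<^sup>2"
      using zero_le_power2[of "c i + c j"] by (simp add: power2_eq_square algebra_simps)
    also have "\<dots> \<le> (infdist (P $ i) L)\<^sup>2 + (infdist (P $ j) L)\<^sup>2"
      using c by (intro add_mono)
    also have "\<dots> = (\<Sum>l\<in>{i, j}. (infdist (P $ l) L)\<^sup>2)"
      using False by simp
    also have "\<dots> \<le> (\<Sum>l\<in>UNIV. (infdist (P $ l) L)\<^sup>2)"
      by (rule sum_mono2) auto
    finally show ?thesis .
  qed
  then show ?thesis
    unfolding cost.simps by (intro cINF_greatest lines_along_nonempty)
qed (simp add: cost_nonneg del: cost.simps)

text \<open>The line through the origin along \<open>v\<close> contains all points. Thus the extent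
  orthogonal to \<open>v\<close> vanishes; it is the whole cost for \<open>STRIP\<close> and a
  factor for \<open>OBB\<close>.\<close>

lemma cost_eq_0_if_collinear:
  assumes "norm v = 1" and P: "\<And>l. P $ l = 0 \<or> P $ l = complex_vec v"
  shows "cost D (direction v) P = 0"
proof -
  have extent_0: "extent (perp (direction v)) P = 0"
    unfolding perp_direction[OF assms(1)]
  proof (rule extent_eq_0I)
    show "(P $ i - P $ j) \<bullet> complex_vec (\<i> * v) = 0" for i j
      using P[of i] P[of j] by (auto simp: inner_diff_left inner_complex_def)
  qed (use assms in \<open>simp add: norm_mult\<close>)
  show ?thesis
  proof (cases D)
    case PC
    define L where "L = {0 + s *\<^sub>R complex_vec v | s. True}"
    have "\<exists>s. P $ l = 0 + s *\<^sub>R complex_vec v" for l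
      using P[of l] by (auto intro: exI[of _ 0] exI[of _ 1])
    then have "P $ l \<in> L" for l
      by (simp add: L_def)
    then have "(\<Sum>l\<in>UNIV. (infdist (P $ l) L)\<^sup>2) = 0"
      by simp
    moreover have "L \<in> lines_along (direction v)"
      unfolding lines_along_direction[OF assms(1)] L_def by blast
    ultimately have "cost PC (direction v) P \<le> 0"
      using cINF_lower[OF pc_cost_bdd_below, of L "direction v" P] by simp
    then show ?thesis
      using cost_nonneg[of PC "direction v" P] PC by simp
  qed (simp_all add: extent_0)
qed

text \<open>Only \<open>OBB\<close> needs the first alternative: its product of extents vanishes as
  soon as either factor does.\<close>

lemma cost_eq_0_imp_parallel_or_orthogonal:
  assumes "cost D (direction z) P = 0" "norm z = 1"
  shows "(P $ i - P $ j) \<bullet> complex_vec z = 0 \<or> (P $ i - P $ j) \<bullet> complex_vec (\<i> * z) = 0"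
proof -
  have iz: "norm (\<i> * z) = 1"
    using assms by (simp add: norm_mult)
  show ?thesis
  proof (cases D)
    case PC
    then show ?thesis
      using pc_cost_lower_bound[OF assms(2), of P i j] assms(1) by simp
  next
    case OBB
    then have "extent (direction z) P = 0 \<or> extent (direction (\<i> * z)) P = 0"
      using assms perp_direction by simp
    then show ?thesis
      using extent_eq_0D[of z P] extent_eq_0D[of "\<i> * z" P] assms(2) iz by blast
  next
    case STRIP
    then have "extent (direction (\<i> * z)) P = 0"
      using assms perp_direction by simp
    then show ?thesis
      using extent_eq_0D[of "\<i> * z" P] iz by blast
  qed
qed

text \<open>The quotient of the two unit numbers, \<open>w = z * cnj v\<close>, is real or purely
  imaginary according to which inner product vanishes, so its square is 1 or -1.\<close>

lemma pow4_eq_if_parallel_or_orthogonal: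
  fixes v z :: complex
  assumes "norm v = 1" "norm z = 1" "v \<bullet> z = 0 \<or> v \<bullet> (\<i> * z) = 0"
  shows "z ^ 4 = v ^ 4"
proof -
  define w where "w = z * cnj v"
  have "w * cnj w = 1"
    unfolding complex_norm_square[symmetric] using assms by (simp add: w_def norm_mult)
  moreover have "cnj w = w \<or> cnj w = - w"
    using assms(3) by (auto simp: w_def complex_eq_iff inner_complex_def algebra_simps)
  ultimately have "w\<^sup>2 = 1 \<or> w\<^sup>2 = - 1"
    by (auto simp: power2_eq_square minus_equation_iff)
  then have "w ^ 4 = 1"
    by (auto simp: power4_eq_xxxx power2_eq_square)
  have "v * cnj v = 1"
    using assms by (simp add: complex_norm_square[symmetric])
  then have "z = w * v"
    by (simp add: w_def mult.assoc mult.commute)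
  then show ?thesis
    by (simp add: power_mult_distrib \<open>w ^ 4 = 1\<close>)
qed

lemma cost_ratio_eq_infinity:
  assumes "cost D \<gamma> P = 0" "cost D \<alpha> P \<noteq> 0"
  shows "cost_ratio D \<alpha> P = \<infinity>"
proof -
  have "(INF \<gamma>. cost D \<gamma> P) = 0"
  proof (rule antisym)
    have "bdd_below (range (\<lambda>\<gamma>. cost D \<gamma> P))"
      using cost_nonneg by (auto intro!: bdd_belowI[of _ 0])
    from cINF_lower[OF this, of \<gamma>] show "(INF \<gamma>. cost D \<gamma> P) \<le> 0"
      using assms by simp
  qed (auto intro!: cINF_greatest cost_nonneg)
  then show ?thesis
    using assms by (simp add: cost_ratio_def)
qed

section \<open>The disc of point sets and the conclusion\<close>

lemma stability_ratio_of_eq_infinity: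
  fixes \<A> :: "(real^2)^'n::finite \<Rightarrow> orientation" and T :: real
  assumes "CARD('n) \<ge> 3" and "T > 0" and \<A>: "continuous_algorithm T \<A>"
  shows "stability_ratio_of T D \<A> = \<infinity>"
proof -
  obtain i j k :: 'n where ijk: "i \<noteq> j" "i \<noteq> k" "j \<noteq> k"
    using assms(1) by (auto simp: numeral_3_eq_3 card_le_Suc_iff)
  \<comment> \<open>The fixed vector \<open>e\<close> is \<open>complex_vec 1\<close>. Index
    \<open>i\<close> stays at the origin; without it, the points \<open>j\<close> and
    \<open>k\<close> would coincide at \<open>z = 1/2\<close>.\<close>
  define P :: "complex \<Rightarrow> (real^2)^'n" where
    "P z = (\<chi> l. complex_vec (if l = j then z else if l = k then of_real (1 - norm z) else 0))" for z
  have P_nth: "P z $ i = 0" "P z $ j = complex_vec z"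
      "P z $ k = complex_vec (of_real (1 - norm z))" for z
    using ijk by (simp_all add: P_def)
  have P_point_set: "point_set (P z)" for z
  proof (cases "z = 0")
    case True
    then have "P z $ k \<noteq> P z $ i"
      using complex_vec_eq_iff[of 1 0] by (simp add: P_nth del: complex_vec_eq_iff)
    then show ?thesis
      unfolding point_set_def by blast
  next
    case False
    then have "P z $ j \<noteq> P z $ i"
      using complex_vec_eq_iff[of z 0] by (simp add: P_nth del: complex_vec_eq_iff)
    then show ?thesis
      unfolding point_set_def by blast
  qed
  have "continuous_on UNIV (\<lambda>z. \<A> (P z))"
  proof (rule continuous_on_if_continuous_along_paths[OF convex_UNIV \<open>T > 0\<close>])
    fix g :: "real \<Rightarrow> complex"
    assume g: "continuous_on {0..T} g"
    have "continuous_on {0..T} (\<lambda>t. P (g t) $ l)" for l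
      unfolding P_def vec_lambda_beta
      by (intro continuous_on_compose2[OF continuous_on_complex_vec[of UNIV]])
         (cases "l = j"; cases "l = k"; auto intro!: continuous_intros g)+
    then show "continuous_on {0..T} (\<lambda>t. \<A> (P (g t)))"
      using \<A> P_point_set by (simp add: continuous_algorithm_def moving_point_set_def)
  qed
  then have "continuous_on (cball 0 1) (\<lambda>z. direction_pow4 (\<A> (P z)))"
    by (intro continuous_on_compose2[OF continuous_on_direction_pow4])
       (auto intro: continuous_on_subset)
  \<comment> \<open>The obstruction yields a collinear configuration \<open>P v\<close> whose output
    is neither parallel nor orthogonal to \<open>v\<close>.\<close>
  from no_circle_valued_extension_of_power[OF this norm_direction_pow4, of 4]
  obtain v where v: "norm v = 1" "direction_pow4 (\<A> (P v)) \<noteq> v ^ 4"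
    by auto
  obtain z where z: "norm z = 1" "\<A> (P v) = direction z"
    by (rule direction_cases)
  have "cost D (direction v) (P v) = 0"
    by (rule cost_eq_0_if_collinear) (use v in \<open>auto simp: P_def\<close>)
  moreover have "cost D (\<A> (P v)) (P v) \<noteq> 0"
  proof
    assume "cost D (\<A> (P v)) (P v) = 0"
    then have "v \<bullet> z = 0 \<or> v \<bullet> (\<i> * z) = 0"
      using cost_eq_0_imp_parallel_or_orthogonal[of D z "P v" j i] z by (simp add: P_nth)
    then show False
      using pow4_eq_if_parallel_or_orthogonal[of v z] v z direction_pow4[of z] by auto
  qed
  ultimately have ratio: "cost_ratio D (\<A> (P v)) (P v) = \<infinity>"
    by (rule cost_ratio_eq_infinity)
  \<comment> \<open>A motionless point set suffices, since the ratio at \<open>P v\<close> alone is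
    already infinite.\<close>
  have "moving_point_set T (\<lambda>_. P v)"
    using P_point_set by (simp add: moving_point_set_def)
  then have "(SUP t\<in>{0..T}. cost_ratio D (\<A> (P v)) (P v)) \<le> stability_ratio_of T D \<A>"
    unfolding stability_ratio_of_def by (intro SUP_upper2[of "\<lambda>_. P v"]) auto
  then show ?thesis
    using \<open>T > 0\<close> by (simp add: ratio)
qed

theorem theorem1:
  fixes T :: real
  assumes "CARD('n::finite) \<ge> 3" and "T > 0"
  shows "topological_stability_ratio TYPE('n) T OBB = \<infinity>
    \<and> topological_stability_ratio TYPE('n) T PC = \<infinity>
    \<and> topological_stability_ratio TYPE('n) T STRIP = \<infinity>
    \<and> (\<forall>D. \<forall>\<A> :: (real^2)^'n \<Rightarrow> orientation. continuous_algorithm T \<A> \<longrightarrow>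
         (SUP P\<in>{P. moving_point_set T P}. SUP t\<in>{0..T}.
            cost_ratio D (\<A> (P t)) (P t)) = \<infinity>)"
proof -
  have *: "stability_ratio_of T D \<A> = \<infinity>" if "continuous_algorithm T \<A>"
    for D and \<A> :: "(real^2)^'n \<Rightarrow> orientation"
    using stability_ratio_of_eq_infinity[OF assms that] .
  \<comment> \<open>The infimum of a family whose values all equal the top element of
    \<open>ereal\<close> is again that element.\<close>
  then have "topological_stability_ratio TYPE('n) T D = \<infinity>" for D
    unfolding topological_stability_ratio_def by (simp add: INF_eqI top_ereal_def[symmetric])
  then show ?thesis
    using * unfolding stability_ratio_of_def by simp
qed

end
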